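(* Let $D\ge1$ and $M\ge0$ be integers. With $d=D-1$, $s_d=d(d+1)/2$, $E=\bigl(\sum_{k=2}^{D+1}k-s_d\bigr)M+2$ and $h(x,z)=(1-x)\prod_{k=1}^{d}\bigl((1+z)^{k}-x\bigr)$, $$G[M^{(D)}]=\frac{(DM)!}{(M!)^{D}}\;[z^{DM}]\;(1+z)^{E}\int_0^1h(x,z)^{M}\,dx.$$
   Context: Let $S$ be the hyper-Catalan generating series in the $D$ variables $t_2,\dots,t_{D+1}$: the unique formal power series with $S=1+\sum_{k=2}^{D+1}t_kS^{k}$. The Geode $G$ is the formal power series defined by $S-1=(t_2+\cdots+t_{D+1})\,G$. $G[M^{(D)}]$ denotes the coefficient of $(t_2t_3\cdots t_{D+1})^{M}$ in $G$. $[z^{j}]$ denotes the coefficient of $z^{j}$. *)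

theory Defs
  imports
    "HOL-Analysis.Analysis"
    "HOL-Library.Poly_Mapping"
    "HOL-Computational_Algebra.Formal_Power_Series"
begin

section \<open>Multivariate formal power series\<close>

text \<open>
  A formal power series in variables indexed by the natural numbers is the family of its
  coefficients, indexed by finitely supported exponent vectors. Series in a given set of
  variables are singled out by \<open>mfps_in\<close> below.
\<close>

typedef 'a mfps = "UNIV :: ((nat \<Rightarrow>\<^sub>0 nat) \<Rightarrow> 'a) set"
  morphisms mfps_coeff Abs_mfps ..

lemma mfps_coeff_Abs [simp]: "mfps_coeff (Abs_mfps f) = f"
  by (simp add: Abs_mfps_inverse)

lemma mfps_eqI: "(\<And>m. mfps_coeff f m = mfps_coeff g m) \<Longrightarrow> f = g"
  by (metis ext mfps_coeff_inject)

lemma mfps_eq_iff: "f = g \<longleftrightarrow> (\<forall>m. mfps_coeff f m = mfps_coeff g m)"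
  using mfps_eqI by auto

definition exp_splits :: "(nat \<Rightarrow>\<^sub>0 nat) \<Rightarrow> ((nat \<Rightarrow>\<^sub>0 nat) \<times> (nat \<Rightarrow>\<^sub>0 nat)) set"
  where "exp_splits m = {(a, b). a + b = m}"

lemma finite_exp_splits [simp]: "finite (exp_splits m)"
proof -
  let ?A = "{a. \<exists>b. a + b = m}"
  let ?F = "{f. \<forall>x. (x \<in> Poly_Mapping.keys m \<longrightarrow> f x \<in> {..Max (range (Poly_Mapping.lookup m))})
                   \<and> (x \<notin> Poly_Mapping.keys m \<longrightarrow> f x = (0::nat))}"
  have fr: "finite (range (Poly_Mapping.lookup m))"
    by (rule finite_subset[of _ "insert 0 (Poly_Mapping.lookup m ` Poly_Mapping.keys m)"])
       (auto simp: in_keys_iff)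
  have "Poly_Mapping.lookup ` ?A \<subseteq> ?F"
  proof clarify
    fix a b x assume m: "m = a + b"
    have le: "Poly_Mapping.lookup a x \<le> Poly_Mapping.lookup m x" for x
      by (simp add: m lookup_add)
    have "Poly_Mapping.lookup a x \<le> Max (range (Poly_Mapping.lookup m))"
      using le[of x] Max_ge[OF fr, of "Poly_Mapping.lookup m x"] by auto
    moreover have "x \<notin> Poly_Mapping.keys m \<Longrightarrow> Poly_Mapping.lookup a x = 0"
      using le[of x] by (simp add: in_keys_iff)
    ultimately show "(x \<in> Poly_Mapping.keys (a + b) \<longrightarrow>
        Poly_Mapping.lookup a x \<in> {..Max (range (Poly_Mapping.lookup (a + b)))}) \<and>
        (x \<notin> Poly_Mapping.keys (a + b) \<longrightarrow> Poly_Mapping.lookup a x = 0)"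
      by (auto simp: m)
  qed
  moreover have "finite ?F" by (rule finite_set_of_finite_funs) auto
  ultimately have "finite (Poly_Mapping.lookup ` ?A)" by (rule finite_subset)
  then have "finite ?A"
    by (rule finite_imageD) (auto simp: inj_on_def)
  then have "finite ((\<lambda>a. (a, m - a)) ` ?A)" by simp
  moreover have "exp_splits m \<subseteq> (\<lambda>a. (a, m - a)) ` ?A"
    by (auto simp: exp_splits_def image_iff)
  ultimately show ?thesis by (rule rev_finite_subset)
qed

instantiation mfps :: (comm_ring_1) comm_ring_1
begin

definition "0 = Abs_mfps (\<lambda>_. 0)"
definition "1 = Abs_mfps (\<lambda>m. if m = 0 then 1 else 0)"
definition "f + g = Abs_mfps (\<lambda>m. mfps_coeff f m + mfps_coeff g m)"
definition "f - g = Abs_mfps (\<lambda>m. mfps_coeff f m - mfps_coeff g m)"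
definition "- f = Abs_mfps (\<lambda>m. - mfps_coeff f m)"
definition "f * g = Abs_mfps (\<lambda>m. \<Sum>(a, b)\<in>exp_splits m. mfps_coeff f a * mfps_coeff g b)"

instance
proof
  fix f g h :: "'a mfps"
  show "f * g = g * f"
    unfolding times_mfps_def
    by (rule arg_cong[of _ _ Abs_mfps], rule ext,
        rule sum.reindex_bij_witness[of _ prod.swap prod.swap])
       (auto simp: exp_splits_def add.commute mult.commute)
  show "f * g * h = f * (g * h)"
  proof (rule mfps_eqI)
    fix m
    let ?f = "mfps_coeff f" and ?g = "mfps_coeff g" and ?h = "mfps_coeff h"
    have "mfps_coeff (f * g * h) m =
        (\<Sum>p\<in>exp_splits m. \<Sum>q\<in>exp_splits (fst p). ?f (fst q) * ?g (snd q) * ?h (snd p))"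
      by (simp add: times_mfps_def sum_distrib_right case_prod_beta)
    also have "\<dots> = (\<Sum>(p, q)\<in>(SIGMA p:exp_splits m. exp_splits (fst p)).
        ?f (fst q) * ?g (snd q) * ?h (snd p))"
      by (rule sum.Sigma) auto
    also have "\<dots> = (\<Sum>(p, q)\<in>(SIGMA p:exp_splits m. exp_splits (snd p)).
        ?f (fst p) * (?g (fst q) * ?h (snd q)))"
      by (rule sum.reindex_bij_witness[of _
            "\<lambda>(p, q). ((fst p + fst q, snd q), (fst p, fst q))"
            "\<lambda>(p, q). ((fst q, snd q + snd p), (snd q, snd p))"])
         (auto simp: exp_splits_def add.assoc mult.assoc)
    also have "\<dots> = (\<Sum>p\<in>exp_splits m. \<Sum>q\<in>exp_splits (snd p).
        ?f (fst p) * (?g (fst q) * ?h (snd q)))"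
      by (rule sum.Sigma[symmetric]) auto
    also have "\<dots> = mfps_coeff (f * (g * h)) m"
      by (simp add: times_mfps_def sum_distrib_left case_prod_beta)
    finally show "mfps_coeff (f * g * h) m = mfps_coeff (f * (g * h)) m" .
  qed
  show "1 * f = f"
  proof (rule mfps_eqI)
    fix m
    have "mfps_coeff (1 * f) m =
        (\<Sum>p\<in>exp_splits m. if p = (0, m) then mfps_coeff f m else 0)"
      unfolding times_mfps_def one_mfps_def mfps_coeff_Abs
      by (rule sum.cong) (auto simp: exp_splits_def split: if_splits)
    moreover have "(0, m) \<in> exp_splits m" by (simp add: exp_splits_def)
    ultimately show "mfps_coeff (1 * f) m = mfps_coeff f m" by simp
  qed
  show "(f + g) * h = f * h + g * h"
    by (rule mfps_eqI)
       (simp add: times_mfps_def plus_mfps_def case_prod_beta distrib_right sum.distrib)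
  show "(0::'a mfps) \<noteq> 1"
    by (auto simp: zero_mfps_def one_mfps_def mfps_eq_iff)
qed (auto simp: mfps_eq_iff zero_mfps_def plus_mfps_def minus_mfps_def uminus_mfps_def
        algebra_simps)

end

definition mfps_var :: "nat \<Rightarrow> 'a::comm_ring_1 mfps"
  where "mfps_var k = Abs_mfps (\<lambda>m. if m = Poly_Mapping.single k 1 then 1 else 0)"

definition mfps_in :: "nat set \<Rightarrow> 'a::comm_ring_1 mfps set"
  where "mfps_in V = {f. \<forall>m. \<not> Poly_Mapping.keys m \<subseteq> V \<longrightarrow> mfps_coeff f m = 0}"


section \<open>The hyper-Catalan series and the Geode\<close>

text \<open>
  Both series live in the power series ring in the variables $t_2, \ldots, t_{D+1}$. That the
  descriptions single out exactly one series is shown in \<open>hyper_catalan_ex1\<close> and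
  \<open>geode_ex1\<close>.
\<close>

definition hyper_catalan :: "nat \<Rightarrow> real mfps"
  where "hyper_catalan D = (THE S. S \<in> mfps_in {2..D+1} \<and>
           S = 1 + (\<Sum>k=2..D+1. mfps_var k * S ^ k))"

definition geode :: "nat \<Rightarrow> real mfps"
  where "geode D = (THE G. G \<in> mfps_in {2..D+1} \<and>
           hyper_catalan D - 1 = (\<Sum>k=2..D+1. mfps_var k) * G)"

definition diag_exponent :: "nat \<Rightarrow> nat \<Rightarrow> (nat \<Rightarrow>\<^sub>0 nat)"
  where "diag_exponent D M = (\<Sum>k=2..D+1. Poly_Mapping.single k M)"

definition geode_diag :: "nat \<Rightarrow> nat \<Rightarrow> real"
  where "geode_diag D M = mfps_coeff (geode D) (diag_exponent D M)"


section \<open>Integrating a power series whose coefficients depend on a real parameter\<close>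

text \<open>
  For $f(x, z) = \sum_n f_n(x) z^n$ this is $\int_a^b f(x, z)\,dx
  = \sum_n \bigl(\int_a^b f_n(x)\,dx\bigr) z^n$. It is only used where every $f_n$ is a
  polynomial in $x$, hence integrable.
\<close>

definition fps_param_integral :: "real \<Rightarrow> real \<Rightarrow> (real \<Rightarrow> real fps) \<Rightarrow> real fps"
  where "fps_param_integral a b f = Abs_fps (\<lambda>n. integral {a..b} (\<lambda>x. fps_nth (f x) n))"

definition geode_kernel :: "nat \<Rightarrow> real \<Rightarrow> real fps"
  where "geode_kernel d x =
           (1 - fps_const x) * (\<Prod>k=1..d. (1 + fps_X) ^ k - fps_const x)"


text \<open>
  The natural number subtraction in the exponent of $1 + z$ does not truncate.
\<close>

lemma geode_exponent_diff:
  fixes D :: nat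
  assumes "D \<ge> 1"
  shows "(D - 1) * (D - 1 + 1) div 2 \<le> (\<Sum>k=2..D+1. k)"
    and "(\<Sum>k=2..D+1. k) - (D - 1) * (D - 1 + 1) div 2 = 2 * D"
proof -
  have "(\<Sum>k=2..D+1. k) = (D - 1) * (D - 1 + 1) div 2 + 2 * D"
    using assms
  proof (induction D rule: dec_induct)
    case base
    show ?case by simp
  next
    case (step n)
    have "even ((n - 1) * n)" by (cases n) auto
    then have "n * (n + 1) div 2 = (n - 1) * n div 2 + n"
      using step.hyps by (cases n) auto
    with step show ?case by simp
  qed
  then show "(D - 1) * (D - 1 + 1) div 2 \<le> (\<Sum>k=2..D+1. k)"
    and "(\<Sum>k=2..D+1. k) - (D - 1) * (D - 1 + 1) div 2 = 2 * D"
    by simp_all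
qed


section \<open>Existence and uniqueness\<close>

lemma mfps_coeff_0 [simp]: "mfps_coeff 0 m = 0"
  and mfps_coeff_1: "mfps_coeff 1 m = (if m = 0 then 1 else 0)"
  and mfps_coeff_add [simp]: "mfps_coeff (f + g) m = mfps_coeff f m + mfps_coeff g m"
  and mfps_coeff_diff [simp]: "mfps_coeff (f - g) m = mfps_coeff f m - mfps_coeff g m"
  and mfps_coeff_minus [simp]: "mfps_coeff (- f) m = - mfps_coeff f m"
  by (simp_all add: zero_mfps_def one_mfps_def plus_mfps_def minus_mfps_def uminus_mfps_def)

lemma mfps_coeff_mult:
  "mfps_coeff (f * g) m = (\<Sum>(a, b)\<in>exp_splits m. mfps_coeff f a * mfps_coeff g b)"
  by (simp add: times_mfps_def)

lemma mfps_coeff_sum: "mfps_coeff (sum f A) m = (\<Sum>x\<in>A. mfps_coeff (f x) m)"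
  by (induction A rule: infinite_finite_induct) auto

lemma mfps_coeff_var_mult_add:
  "mfps_coeff (mfps_var k * f) (Poly_Mapping.single k 1 + m) = mfps_coeff f m"
proof -
  have "mfps_coeff (mfps_var k * f) (Poly_Mapping.single k 1 + m) =
      (\<Sum>p\<in>exp_splits (Poly_Mapping.single k 1 + m).
         if p = (Poly_Mapping.single k 1, m) then mfps_coeff f m else 0)"
    unfolding mfps_coeff_mult mfps_var_def mfps_coeff_Abs
    by (rule sum.cong) (auto simp: exp_splits_def split: if_splits)
  moreover have "(Poly_Mapping.single k 1, m) \<in> exp_splits (Poly_Mapping.single k 1 + m)"
    by (simp add: exp_splits_def)
  ultimately show ?thesis by simp
qed

lemma mfps_coeff_var_mult_0:
  assumes "Poly_Mapping.lookup m k = 0"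
  shows "mfps_coeff (mfps_var k * f) m = 0"
  unfolding mfps_coeff_mult mfps_var_def mfps_coeff_Abs
  by (rule sum.neutral) (use assms in \<open>auto simp: exp_splits_def lookup_add\<close>)

lemma exp_split_single:
  assumes "Poly_Mapping.lookup m k > 0"
  obtains n where "m = Poly_Mapping.single k (1::nat) + n"
proof
  show "m = Poly_Mapping.single k (1::nat) + (m - Poly_Mapping.single k 1)"
    using assms
    by (intro poly_mapping_eqI) (auto simp: lookup_add lookup_minus lookup_single when_def)
qed

lemma mfps_in_0 [intro]: "0 \<in> mfps_in V"
  and mfps_in_1 [intro]: "1 \<in> mfps_in V"
  and mfps_in_add [intro]: "f \<in> mfps_in V \<Longrightarrow> g \<in> mfps_in V \<Longrightarrow> f + g \<in> mfps_in V"
  and mfps_in_diff [intro]: "f \<in> mfps_in V \<Longrightarrow> g \<in> mfps_in V \<Longrightarrow> f - g \<in> mfps_in V"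
  by (auto simp: mfps_in_def mfps_coeff_1)

lemma mfps_in_var [intro]: "k \<in> V \<Longrightarrow> mfps_var k \<in> mfps_in V"
  by (auto simp: mfps_in_def mfps_var_def)

lemma mfps_in_mult [intro]:
  assumes "f \<in> mfps_in V" "g \<in> mfps_in V"
  shows "f * g \<in> mfps_in V"
  unfolding mfps_in_def
proof (intro CollectI allI impI)
  fix m :: "nat \<Rightarrow>\<^sub>0 nat" assume m: "\<not> Poly_Mapping.keys m \<subseteq> V"
  have "mfps_coeff f a * mfps_coeff g b = 0" if "a + b = m" for a b
  proof -
    have "\<not> Poly_Mapping.keys a \<subseteq> V \<or> \<not> Poly_Mapping.keys b \<subseteq> V"
      using m keys_add[of a b] that by blast
    then show ?thesis using assms by (auto simp: mfps_in_def)
  qed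
  then show "mfps_coeff (f * g) m = 0"
    unfolding mfps_coeff_mult by (intro sum.neutral) (auto simp: exp_splits_def)
qed

lemma mfps_in_power [intro]: "f \<in> mfps_in V \<Longrightarrow> f ^ n \<in> mfps_in V"
  by (induction n) auto

lemma mfps_in_sum [intro]: "(\<And>x. x \<in> A \<Longrightarrow> f x \<in> mfps_in V) \<Longrightarrow> sum f A \<in> mfps_in V"
  by (induction A rule: infinite_finite_induct) auto

definition exp_deg :: "(nat \<Rightarrow>\<^sub>0 nat) \<Rightarrow> nat"
  where "exp_deg m = (\<Sum>k\<in>Poly_Mapping.keys m. Poly_Mapping.lookup m k)"

lemma exp_deg_superset:
  "finite A \<Longrightarrow> Poly_Mapping.keys m \<subseteq> A \<Longrightarrow> exp_deg m = (\<Sum>k\<in>A. Poly_Mapping.lookup m k)"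
  unfolding exp_deg_def by (rule sum.mono_neutral_left) (auto simp: in_keys_iff)

lemma exp_deg_add: "exp_deg (a + b) = exp_deg a + exp_deg b"
proof -
  let ?A = "Poly_Mapping.keys a \<union> Poly_Mapping.keys b"
  have "Poly_Mapping.keys (a + b) \<subseteq> ?A" by (rule keys_add)
  then show ?thesis
    by (simp add: exp_deg_superset[of ?A] lookup_add sum.distrib)
qed

lemma exp_deg_single [simp]: "exp_deg (Poly_Mapping.single k n) = n"
  by (simp add: exp_deg_def)

definition mfps_agree :: "nat \<Rightarrow> 'a mfps \<Rightarrow> 'a mfps \<Rightarrow> bool"
  where "mfps_agree n f g \<longleftrightarrow> (\<forall>m. exp_deg m < n \<longrightarrow> mfps_coeff f m = mfps_coeff g m)"

lemma mfps_agree_refl [simp]: "mfps_agree n f f"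
  and mfps_agree_zero [simp]: "mfps_agree 0 f g"
  by (auto simp: mfps_agree_def)

lemma mfps_agree_add:
  "mfps_agree n f f' \<Longrightarrow> mfps_agree n g g' \<Longrightarrow> mfps_agree n (f + g) (f' + g')"
  for f :: "'a::comm_ring_1 mfps"
  by (auto simp: mfps_agree_def)

lemma mfps_agree_sum:
  "(\<And>x. x \<in> A \<Longrightarrow> mfps_agree n (f x) (g x)) \<Longrightarrow> mfps_agree n (sum f A) (sum g A)"
  for f :: "'b \<Rightarrow> 'a::comm_ring_1 mfps"
  by (auto simp: mfps_agree_def mfps_coeff_sum intro: sum.cong)

lemma mfps_agree_mult:
  fixes f :: "'a::comm_ring_1 mfps"
  assumes "mfps_agree n f f'" "mfps_agree n g g'"
  shows "mfps_agree n (f * g) (f' * g')"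
  unfolding mfps_agree_def mfps_coeff_mult
  by (intro allI impI sum.cong)
     (use assms in \<open>auto simp: exp_splits_def exp_deg_add mfps_agree_def\<close>)

lemma mfps_agree_power:
  "mfps_agree n f g \<Longrightarrow> mfps_agree n (f ^ k) (g ^ k)" for f :: "'a::comm_ring_1 mfps"
  by (induction k) (auto intro: mfps_agree_mult)

lemma mfps_agree_var_mult:
  fixes f :: "'a::comm_ring_1 mfps"
  assumes "mfps_agree n f g"
  shows "mfps_agree (Suc n) (mfps_var k * f) (mfps_var k * g)"
  unfolding mfps_agree_def
proof (intro allI impI)
  fix m assume m: "exp_deg m < Suc n"
  show "mfps_coeff (mfps_var k * f) m = mfps_coeff (mfps_var k * g) m"
  proof (cases "Poly_Mapping.lookup m k = 0")
    case True
    then show ?thesis by (simp add: mfps_coeff_var_mult_0)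
  next
    case False
    then have "Poly_Mapping.lookup m k > 0" by simp
    then obtain l where l: "m = Poly_Mapping.single k 1 + l"
      by (rule exp_split_single)
    then have "exp_deg l < n" using m by (simp add: exp_deg_add)
    then have "mfps_coeff f l = mfps_coeff g l" using assms by (simp add: mfps_agree_def)
    then show ?thesis by (simp only: l mfps_coeff_var_mult_add)
  qed
qed

lemma mfps_fixpoint_ex1:
  fixes \<Phi> :: "'a::comm_ring_1 mfps \<Rightarrow> 'a mfps"
  assumes contr: "\<And>n f g. mfps_agree n f g \<Longrightarrow> mfps_agree (Suc n) (\<Phi> f) (\<Phi> g)"
    and closed: "\<And>f. f \<in> mfps_in V \<Longrightarrow> \<Phi> f \<in> mfps_in V"
  shows "\<exists>!f. f \<in> mfps_in V \<and> f = \<Phi> f"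
proof (rule ex_ex1I)
  define T where "T n = (\<Phi> ^^ n) 0" for n
  have T_in: "T n \<in> mfps_in V" for n
    by (induction n) (auto simp: T_def closed)
  have T_agree: "mfps_agree n (T n) (T (n + p))" for n p
    by (induction n) (auto simp: T_def intro: contr)
  define F where "F = Abs_mfps (\<lambda>m. mfps_coeff (T (Suc (exp_deg m))) m)"
  have F_agree: "mfps_agree n F (T n)" for n
    unfolding mfps_agree_def
  proof (intro allI impI)
    fix m assume "exp_deg m < n"
    then obtain p where "n = Suc (exp_deg m) + p"
      by (metis Suc_leI le_iff_add)
    then show "mfps_coeff F m = mfps_coeff (T n) m"
      using T_agree[of "Suc (exp_deg m)" p] by (simp add: F_def mfps_agree_def)
  qed
  have "F \<in> mfps_in V"
    using T_in by (auto simp: mfps_in_def F_def)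
  moreover have "F = \<Phi> F"
  proof (rule mfps_eqI)
    fix m
    let ?n = "exp_deg m"
    have "mfps_coeff (\<Phi> F) m = mfps_coeff (\<Phi> (T ?n)) m"
      using contr[OF F_agree[of ?n]] by (auto simp: mfps_agree_def)
    then show "mfps_coeff F m = mfps_coeff (\<Phi> F) m"
      by (simp add: F_def T_def)
  qed
  ultimately show "\<exists>f. f \<in> mfps_in V \<and> f = \<Phi> f" by blast
next
  fix f g assume f: "f \<in> mfps_in V \<and> f = \<Phi> f" and g: "g \<in> mfps_in V \<and> g = \<Phi> g"
  have "mfps_agree n f g" for n
    by (induction n) (use contr f g in \<open>metis mfps_agree_zero\<close>)+
  then show "f = g"
    by (intro mfps_eqI) (auto simp: mfps_agree_def)
qed

lemma hyper_catalan_ex1_aux: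
  "\<exists>!S :: 'a::comm_ring_1 mfps. S \<in> mfps_in A \<and> S = 1 + (\<Sum>k\<in>A. mfps_var k * S ^ k)"
  by (rule mfps_fixpoint_ex1)
     (auto intro!: mfps_agree_add mfps_agree_sum mfps_agree_var_mult mfps_agree_power)

lemma hyper_catalan_ex1:
  "\<exists>!S :: real mfps. S \<in> mfps_in {2..D+1} \<and> S = 1 + (\<Sum>k=2..D+1. mfps_var k * S ^ k)"
  by (rule hyper_catalan_ex1_aux)

lemma hyper_catalan_in: "hyper_catalan D \<in> mfps_in {2..D+1}"
  and hyper_catalan_eq:
    "hyper_catalan D = 1 + (\<Sum>k=2..D+1. mfps_var k * hyper_catalan D ^ k)"
  using theI'[OF hyper_catalan_ex1[of D]] unfolding hyper_catalan_def[symmetric] by blast+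

lemma mfps_sum_var_mult_eq_0:
  fixes f :: "'a::comm_ring_1 mfps"
  assumes K: "finite A" "K \<in> A" and 0: "(\<Sum>k\<in>A. mfps_var k) * f = 0"
  shows "f = 0"
proof (rule mfps_eqI)
  fix m
  define w where "w m = (\<Sum>k\<in>A - {K}. Poly_Mapping.lookup m k)" for m :: "nat \<Rightarrow>\<^sub>0 nat"
  have "mfps_coeff f m = 0" if "w m = n" for m n
    using that
  proof (induction n arbitrary: m rule: less_induct)
    case (less n)
    let ?m = "Poly_Mapping.single K 1 + m"
    have "mfps_coeff (mfps_var k * f) ?m = 0" if k: "k \<in> A - {K}" for k
    proof (cases "Poly_Mapping.lookup ?m k = 0")
      case True
      then show ?thesis by (rule mfps_coeff_var_mult_0)
    next
      case False
      then have "Poly_Mapping.lookup ?m k > 0" by simp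
      then obtain l where l: "?m = Poly_Mapping.single k 1 + l"
        by (rule exp_split_single)
      have "w ?m = w (Poly_Mapping.single k 1) + w l"
        by (simp only: l w_def lookup_add sum.distrib)
      moreover have "w ?m = w m"
        by (auto simp: w_def lookup_add lookup_single when_def intro!: sum.cong)
      moreover have "w (Poly_Mapping.single k 1) = 1"
        using K k by (simp add: w_def lookup_single when_def)
      ultimately have "w l < n" using less.prems by linarith
      then have "mfps_coeff f l = 0" using less.IH by blast
      then show ?thesis unfolding l by (simp only: mfps_coeff_var_mult_add)
    qed
    then have "(\<Sum>k\<in>A. mfps_coeff (mfps_var k * f) ?m) = mfps_coeff (mfps_var K * f) ?m"
      using K by (simp add: sum.remove)
    moreover have "(\<Sum>k\<in>A. mfps_coeff (mfps_var k * f) ?m) = 0"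
      using 0 by (metis mfps_coeff_0 mfps_coeff_sum sum_distrib_right)
    ultimately show ?case by (simp only: mfps_coeff_var_mult_add)
  qed
  then show "mfps_coeff f m = mfps_coeff 0 m" by simp
qed

lemma geode_exists_aux:
  fixes S :: "'a::comm_ring_1 mfps"
  assumes S_in: "S \<in> mfps_in A" and S: "S = 1 + (\<Sum>k\<in>A. mfps_var k * S ^ k)"
  shows "\<exists>G. G \<in> mfps_in A \<and> S - 1 = (\<Sum>k\<in>A. mfps_var k) * G"
proof -
  define U where "U = (\<Sum>k\<in>A. mfps_var k * (\<Sum>j<k. S ^ j))"
  define t where "t = (\<Sum>k\<in>A. mfps_var k :: 'a mfps)"
  have "\<exists>!G. G \<in> mfps_in A \<and> G = 1 + (\<Sum>k\<in>A. mfps_var k * ((\<Sum>j<k. S ^ j) * G))"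
    by (rule mfps_fixpoint_ex1)
       (auto intro!: mfps_agree_add mfps_agree_sum mfps_agree_var_mult mfps_agree_mult S_in
         mfps_in_add mfps_in_sum mfps_in_mult)
  then obtain G where G_in: "G \<in> mfps_in A"
    and G: "G = 1 + (\<Sum>k\<in>A. mfps_var k * ((\<Sum>j<k. S ^ j) * G))"
    by blast
  have "(\<Sum>k\<in>A. mfps_var k * ((\<Sum>j<k. S ^ j) * G)) = U * G"
    by (simp add: U_def sum_distrib_right[of _ A] mult.assoc)
  with G have inv: "(1 - U) * G = 1"
    by (metis add_diff_cancel_right' left_diff_distrib mult_1)
  have pow: "mfps_var k * S ^ k = mfps_var k + (S - 1) * (mfps_var k * (\<Sum>j<k. S ^ j))" for k
  proof -
    have "S ^ k = 1 + (S - 1) * (\<Sum>j<k. S ^ j)"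
      using power_diff_1_eq[of S k] by (simp add: diff_eq_eq)
    then show ?thesis by (simp only: distrib_left mult_1_right mult.left_commute)
  qed
  have "S - 1 = (\<Sum>k\<in>A. mfps_var k * S ^ k)"
    using S by (metis add_diff_cancel_left')
  also have "\<dots> = t + (S - 1) * U"
    by (simp only: pow sum.distrib t_def U_def sum_distrib_left[symmetric])
  finally have "(S - 1) * (1 - U) = t" by (simp add: right_diff_distrib diff_eq_eq)
  then have "S - 1 = t * G"
    using inv by (metis mult.assoc mult.right_neutral)
  with G_in show ?thesis unfolding t_def by blast
qed

lemma geode_ex1:
  assumes "D \<ge> 1"
  shows "\<exists>!G. G \<in> mfps_in {2..D+1} \<and>
           hyper_catalan D - 1 = (\<Sum>k=2..D+1. mfps_var k) * G"
proof (rule ex_ex1I)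
  show "\<exists>G. G \<in> mfps_in {2..D+1} \<and> hyper_catalan D - 1 = (\<Sum>k=2..D+1. mfps_var k) * G"
    using hyper_catalan_in hyper_catalan_eq by (rule geode_exists_aux)
next
  fix G H
  assume "G \<in> mfps_in {2..D+1} \<and> hyper_catalan D - 1 = (\<Sum>k=2..D+1. mfps_var k) * G"
    and "H \<in> mfps_in {2..D+1} \<and> hyper_catalan D - 1 = (\<Sum>k=2..D+1. mfps_var k) * H"
  then have "(\<Sum>k=2..D+1. mfps_var k) * (G - H) = 0"
    by (simp only: right_diff_distrib) (metis diff_self)
  then have "G - H = 0"
    by (rule mfps_sum_var_mult_eq_0[rotated 2, of _ _ 2]) (use assms in auto)
  then show "G = H" by simp
qed

end

theory Submission
  imports Defs
begin

text \<open>
  The formula is a special case of one for every coefficient of the Geode. For an exponent vector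
  $m$ put $n = \sum_k m_k$, $w = \sum_k k m_k$, $m! = \prod_k m_k!$ and
  $Q_m(x) = \prod_k ((1+z)^{k-2} - x)^{m_k}$; then
  $$G[m] = \frac{n!}{m!}\,[z^n]\,(1+z)^{2n+2} \int_0^1 Q_m(x)\,dx.$$
  On the diagonal $Q_m$ is the $M$-th power of the kernel $h$.

  Since $G$ is determined by $S - 1 = (\sum_k t_k)\,G$, the series with the coefficients on the
  right, call them $c(m)$, only has to be shown to satisfy this equation, that is,
  $\sum_k c(m - e_k) = S[m]$ for $\sum_k m_k = n + 1$, the sum ranging over the $k$ with
  $m_k > 0$. As $\frac{d}{dx} Q_m = -\sum_k m_k Q_{m-e_k}$, the fundamental theorem of calculus
  gives
  $$\sum_k c(m - e_k) = \frac{n!}{m!}\,[z^n]\,(1+z)^{2n+2}\bigl(Q_m(0) - Q_m(1)\bigr).$$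
  Each of the $n + 1$ factors of $Q_m(1)$ is divisible by $z$, so $Q_m(1)$ does not contribute,
  while $(1+z)^{2n+2} Q_m(0) = (1+z)^w$. The sum is therefore $\frac{n!}{m!} \binom{w}{n}$
  (\<open>geode_coeff_lower_sum\<close>), and this is the coefficient $S[m]$.

  The last fact is the case $p = 1$ of a formula for the coefficients of $S^p$
  (\<open>mfps_coeff_power_solution\<close>). It is proved without Lagrange inversion: the relation
  $S^{p+1} = S^p + \sum_k t_k S^{k+p}$ determines all these coefficients recursively, and the
  closed form satisfies the same recursion.
\<close>


section \<open>Lowering an exponent vector\<close>

text \<open>The multifactorial $m! = \prod_k m_k!$, as a real number because it only occurs as a divisor.\<close>

definition exp_fact :: "(nat \<Rightarrow>\<^sub>0 nat) \<Rightarrow> real"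
  where "exp_fact m = (\<Prod>k\<in>Poly_Mapping.keys m. fact (Poly_Mapping.lookup m k))"

text \<open>The weight $\sum_k k\,m_k$, in which the variable $t_k$ counts $k$.\<close>

definition exp_weight :: "(nat \<Rightarrow>\<^sub>0 nat) \<Rightarrow> nat"
  where "exp_weight m = (\<Sum>k\<in>Poly_Mapping.keys m. k * Poly_Mapping.lookup m k)"

lemma exp_fact_superset:
  "finite A \<Longrightarrow> Poly_Mapping.keys m \<subseteq> A \<Longrightarrow>
     exp_fact m = (\<Prod>k\<in>A. fact (Poly_Mapping.lookup m k))"
  unfolding exp_fact_def by (rule prod.mono_neutral_left) (auto simp: in_keys_iff)

lemma exp_weight_superset:
  "finite A \<Longrightarrow> Poly_Mapping.keys m \<subseteq> A \<Longrightarrow>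
     exp_weight m = (\<Sum>k\<in>A. k * Poly_Mapping.lookup m k)"
  unfolding exp_weight_def by (rule sum.mono_neutral_left) (auto simp: in_keys_iff)

lemma exp_fact_nonzero [simp]: "exp_fact m \<noteq> 0"
  by (simp add: exp_fact_def)

lemma exp_fact_0 [simp]: "exp_fact 0 = 1"
  by (simp add: exp_fact_def)

lemma exp_deg_0 [simp]: "exp_deg 0 = 0"
  by (simp add: exp_deg_def)

lemma exp_deg_eq_0_iff: "exp_deg m = 0 \<longleftrightarrow> m = 0"
proof
  assume "exp_deg m = 0"
  then have "Poly_Mapping.lookup m k = 0" for k
    by (cases "k \<in> Poly_Mapping.keys m") (auto simp: exp_deg_def in_keys_iff)
  then show "m = 0" by (intro poly_mapping_eqI) simp
qed simp

text \<open>
  The lemmas below describe $m - e_k$, where $e_k$ is the exponent vector of $t_k$. Subtraction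
  truncates, so most of them require $m_k \neq 0$.
\<close>

lemma lookup_lower:
  "Poly_Mapping.lookup (m - Poly_Mapping.single k (1::nat)) j =
     (if j = k then Poly_Mapping.lookup m k - 1 else Poly_Mapping.lookup m j)"
  by (auto simp: lookup_minus lookup_single when_def)

lemma keys_lower: "Poly_Mapping.keys (m - Poly_Mapping.single k (1::nat)) \<subseteq> Poly_Mapping.keys m"
  by (auto simp: in_keys_iff lookup_minus)

lemma raise_lower:
  assumes "Poly_Mapping.lookup m k \<noteq> 0"
  shows "Poly_Mapping.single k (1::nat) + (m - Poly_Mapping.single k 1) = m"
  using assms by (intro poly_mapping_eqI) 
     (auto simp: lookup_add lookup_lower lookup_single when_def simp del: One_nat_def)

lemma exp_deg_lower:
  assumes "Poly_Mapping.lookup m k \<noteq> 0"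
  shows "exp_deg m = Suc (exp_deg (m - Poly_Mapping.single k (1::nat)))"
  using arg_cong[OF raise_lower[OF assms], of exp_deg] by (simp add: exp_deg_add)

lemma exp_fact_lower:
  assumes "Poly_Mapping.lookup m k \<noteq> 0"
  shows "exp_fact m =
           real (Poly_Mapping.lookup m k) * exp_fact (m - Poly_Mapping.single k (1::nat))"
proof -
  let ?A = "Poly_Mapping.keys m"
  have k: "k \<in> ?A" using assms by (simp add: in_keys_iff)
  show ?thesis
    using assms k
    by (simp add: exp_fact_superset[of ?A "m - Poly_Mapping.single k 1", OF _ keys_lower]
          exp_fact_def[of m] prod.remove[OF _ k] lookup_lower
          fact_reduce del: One_nat_def)
qed

lemma exp_weight_lower:
  assumes "Poly_Mapping.lookup m k \<noteq> 0"
  shows "exp_weight m = k + exp_weight (m - Poly_Mapping.single k (1::nat))"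
proof -
  let ?A = "Poly_Mapping.keys m"
  have k: "k \<in> ?A" using assms by (simp add: in_keys_iff)
  show ?thesis
    using assms k
    by (cases "Poly_Mapping.lookup m k")
       (simp_all add: exp_weight_superset[of ?A "m - Poly_Mapping.single k 1", OF _ keys_lower]
          exp_weight_def[of m] sum.remove[OF _ k]
          lookup_lower del: One_nat_def)
qed

lemma mfps_coeff_var_mult:
  "mfps_coeff (mfps_var k * f) m =
     (if Poly_Mapping.lookup m k = 0 then 0
      else mfps_coeff f (m - Poly_Mapping.single k (1::nat)))"
  using mfps_coeff_var_mult_add[of k f "m - Poly_Mapping.single k 1"]
  by (auto simp: mfps_coeff_var_mult_0 raise_lower simp del: One_nat_def)


section \<open>The coefficients of powers of the hyper-Catalan series\<close>

lemma mfps_coeff_0_power_solution: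
  fixes S :: "real mfps"
  assumes S: "S = 1 + (\<Sum>k\<in>A. mfps_var k * S ^ k)"
  shows "mfps_coeff (S ^ p) 0 = 1"
proof (induction p)
  case 0
  show ?case by (simp add: mfps_coeff_1)
next
  case (Suc p)
  have "mfps_coeff S 0 = 1"
    by (subst S) (simp add: mfps_coeff_1 mfps_coeff_sum mfps_coeff_var_mult)
  moreover have "exp_splits 0 = {(0, 0)}"
    by (auto simp: exp_splits_def exp_deg_add simp flip: exp_deg_eq_0_iff)
  ultimately show ?case using Suc by (simp add: mfps_coeff_mult)
qed

text \<open>
  The recursion for the closed form of the coefficients of $S^p$, cleared of the common factor
  $(n-1)!/m!$. The factor $w + (n+1)p$ on the right is $\sum_k m_k (k + p)$ for a vector of degree
  $n + 1$ and weight $w$.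
\<close>

lemma binomial_solution_step:
  fixes w p n :: nat
  assumes "n > 0"
  shows "real n * (real (Suc p) * real ((w + p) choose n) - real p * real ((w + p - 1) choose n)) =
           (real w + real (Suc n) * real p) * real ((w + p - 1) choose (n - 1))"
proof (cases "w + p = 0")
  case True
  with assms show ?thesis by (cases n) auto
next
  case False
  with assms obtain q N where q: "n = Suc q" and N: "w + p = Suc N"
    by (metis not0_implies_Suc gr_implies_not0)
  have "real (Suc q) * real (Suc N choose Suc q) = real (Suc N) * real (N choose q)"
    by (metis Suc_times_binomial_eq mult.commute of_nat_mult)
  moreover have "real (Suc N choose Suc q) = real (N choose q) + real (N choose Suc q)"
    by simp
  moreover have "real (Suc N) = real w + real p"
    using N by (metis of_nat_add)
  ultimately show ?thesis unfolding q N by simp algebra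
qed

text \<open>
  The formula $[t^m]\,S^p = \frac{p\,n!}{m!}\binom{w+p-1}{n}$ for $m$ of degree $n + 1$ and weight
  $w$. The truncated difference is harmless: $w + p = 0$ forces $p = 0$, and then both sides vanish.
  For $p = 1$ and $A = \{2, \ldots, D+1\}$ these are the hyper-Catalan numbers.
\<close>

lemma mfps_coeff_power_solution:
  fixes S :: "real mfps"
  assumes A: "finite A" and S: "S = 1 + (\<Sum>k\<in>A. mfps_var k * S ^ k)"
    and "Poly_Mapping.keys m \<subseteq> A" "exp_deg m = Suc n"
  shows "mfps_coeff (S ^ p) m =
           real p * fact n / exp_fact m * real ((exp_weight m + p - 1) choose n)"
  using assms(3,4)
proof (induction n arbitrary: m p rule: less_induct)
  case IH: (less n)
  let ?mult = "Poly_Mapping.lookup m" and ?w = "exp_weight m"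
  have S_power: "S ^ Suc p = S ^ p + (\<Sum>k\<in>A. mfps_var k * S ^ (k + p))" for p
  proof -
    have "S ^ Suc p = (1 + (\<Sum>k\<in>A. mfps_var k * S ^ k)) * S ^ p"
      using S by simp
    then show ?thesis
      by (simp add: distrib_right sum_distrib_right power_add mult.assoc)
  qed
  \<comment> \<open>The induction hypothesis on the degree evaluates the increment from \<open>S ^ p\<close> to \<open>S ^ Suc p\<close>.\<close>
  have T: "(\<Sum>k\<in>A. mfps_coeff (mfps_var k * S ^ (k + p)) m) =
      fact n / exp_fact m *
        (real (Suc p) * real ((?w + p) choose n) - real p * real ((?w + p - 1) choose n))" for p
  proof (cases n)
    case 0
    have "mfps_coeff (mfps_var k * S ^ (k + p)) m = real (?mult k) / exp_fact m" for k
    proof (cases "?mult k = 0")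
      case False
      then have "m - Poly_Mapping.single k 1 = 0"
        using exp_deg_lower[OF False] IH.prems 0 by (simp add: exp_deg_eq_0_iff)
      then show ?thesis
        using exp_fact_lower[OF False] False
        by (simp add: mfps_coeff_var_mult mfps_coeff_0_power_solution[OF S] del: One_nat_def)
    qed (simp add: mfps_coeff_var_mult)
    then have "(\<Sum>k\<in>A. mfps_coeff (mfps_var k * S ^ (k + p)) m) =
        real (\<Sum>k\<in>A. ?mult k) / exp_fact m"
      by (simp add: sum_divide_distrib)
    also have "(\<Sum>k\<in>A. ?mult k) = Suc 0"
      using IH.prems A 0 by (simp add: exp_deg_superset)
    finally show ?thesis using 0 by simp
  next
    case (Suc q)
    let ?B = "fact q / exp_fact m * real ((?w + p - 1) choose q)"
    have "mfps_coeff (mfps_var k * S ^ (k + p)) m =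
        (real (k * ?mult k) + real p * real (?mult k)) * ?B" for k
    proof (cases "?mult k = 0")
      case False
      have "mfps_coeff (S ^ (k + p)) (m - Poly_Mapping.single k 1) =
          real (k + p) * fact q / exp_fact (m - Poly_Mapping.single k 1) *
            real ((?w + p - 1) choose q)"
        using IH.IH[of q "m - Poly_Mapping.single k 1" "k + p"] IH.prems keys_lower[of m k]
          exp_deg_lower[OF False] exp_weight_lower[OF False] Suc
        by (simp add: add_ac del: One_nat_def)
      then show ?thesis
        using exp_fact_lower[OF False] False
        by (simp add: mfps_coeff_var_mult field_simps del: One_nat_def)
    qed (simp add: mfps_coeff_var_mult)
    then have "(\<Sum>k\<in>A. mfps_coeff (mfps_var k * S ^ (k + p)) m) =
        (real (\<Sum>k\<in>A. k * ?mult k) + real p * real (\<Sum>k\<in>A. ?mult k)) * ?B"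
      by (simp only: sum.distrib of_nat_sum flip: sum_distrib_right sum_distrib_left)
    also have "(\<Sum>k\<in>A. k * ?mult k) = ?w"
      using IH.prems A by (simp add: exp_weight_superset)
    also have "(\<Sum>k\<in>A. ?mult k) = Suc n"
      using IH.prems A by (simp add: exp_deg_superset)
    also have "(real ?w + real p * real (Suc n)) * ?B = fact q / exp_fact m *
        ((real ?w + real (Suc n) * real p) * real ((?w + p - 1) choose (n - 1)))"
      using Suc by (simp add: mult_ac)
    also have "\<dots> = fact q / exp_fact m * (real n *
        (real (Suc p) * real ((?w + p) choose n) - real p * real ((?w + p - 1) choose n)))"
      using Suc by (simp only: binomial_solution_step zero_less_Suc)
    also have "\<dots> = fact n / exp_fact m *
        (real (Suc p) * real ((?w + p) choose n) - real p * real ((?w + p - 1) choose n))"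
      by (simp add: Suc mult_ac)
    finally show ?thesis .
  qed
  show ?case
  proof (induction p)
    case 0
    show ?case using IH.prems by (auto simp: mfps_coeff_1)
  next
    case (Suc p)
    show ?case
      unfolding S_power mfps_coeff_add mfps_coeff_sum T Suc.IH
      by (simp add: algebra_simps add_divide_distrib)
  qed
qed


section \<open>Series with a real parameter\<close>

text \<open>
  Coefficientwise differentiation with respect to the parameter $x$ at every real point; it is
  unrelated to the formal derivative in $z$.
\<close>

definition fps_has_deriv :: "(real \<Rightarrow> real fps) \<Rightarrow> (real \<Rightarrow> real fps) \<Rightarrow> bool"
  where "fps_has_deriv f f' \<longleftrightarrow>
    (\<forall>n x. ((\<lambda>x. fps_nth (f x) n) has_real_derivative fps_nth (f' x) n) (at x))"

lemma fps_has_deriv_const: "fps_has_deriv (\<lambda>_. c) (\<lambda>_. 0)"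
  by (simp add: fps_has_deriv_def)

lemma fps_has_deriv_diff_const: "fps_has_deriv (\<lambda>x. c - fps_const x) (\<lambda>_. - 1)"
  unfolding fps_has_deriv_def by (auto intro!: derivative_eq_intros)

lemma fps_has_deriv_mult:
  assumes "fps_has_deriv f f'" "fps_has_deriv g g'"
  shows "fps_has_deriv (\<lambda>x. f x * g x) (\<lambda>x. f' x * g x + f x * g' x)"
  unfolding fps_has_deriv_def
proof (intro allI)
  fix n x
  have "((\<lambda>x. \<Sum>i=0..n. fps_nth (f x) i * fps_nth (g x) (n - i)) has_real_derivative
      (\<Sum>i=0..n. fps_nth (f' x) i * fps_nth (g x) (n - i) + fps_nth (g' x) (n - i) * fps_nth (f x) i))
      (at x)"
    using assms unfolding fps_has_deriv_def by (intro DERIV_sum DERIV_mult) auto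
  then show "((\<lambda>x. fps_nth (f x * g x) n) has_real_derivative
      fps_nth (f' x * g x + f x * g' x) n) (at x)"
    by (simp add: fps_mult_nth sum.distrib mult.commute)
qed

lemma fps_has_deriv_power:
  assumes "fps_has_deriv f f'"
  shows "fps_has_deriv (\<lambda>x. f x ^ k) (\<lambda>x. of_nat k * f' x * f x ^ (k - 1))"
proof (induction k)
  case 0
  show ?case by (simp add: fps_has_deriv_const)
next
  case (Suc k)
  have "(\<lambda>x. f' x * f x ^ k + f x * (of_nat k * f' x * f x ^ (k - 1))) =
      (\<lambda>x. of_nat (Suc k) * f' x * f x ^ (Suc k - 1))"
    by (cases k) (auto simp: algebra_simps)
  then show ?case
    using fps_has_deriv_mult[OF assms Suc] by (simp only: power_Suc)
qed

lemma fps_has_deriv_prod: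
  assumes "finite A" "\<And>j. j \<in> A \<Longrightarrow> fps_has_deriv (f j) (f' j)"
  shows "fps_has_deriv (\<lambda>x. \<Prod>j\<in>A. f j x) (\<lambda>x. \<Sum>k\<in>A. f' k x * (\<Prod>j\<in>A - {k}. f j x))"
  using assms
proof (induction A rule: finite_induct)
  case empty
  show ?case by (simp add: fps_has_deriv_const)
next
  case (insert a A)
  have "f' a x * (\<Prod>j\<in>A. f j x) + f a x * (\<Sum>k\<in>A. f' k x * (\<Prod>j\<in>A - {k}. f j x)) =
      (\<Sum>k\<in>insert a A. f' k x * (\<Prod>j\<in>insert a A - {k}. f j x))" for x
  proof -
    have "(\<Sum>k\<in>A. f a x * (f' k x * (\<Prod>j\<in>A - {k}. f j x))) =
        (\<Sum>k\<in>A. f' k x * (\<Prod>j\<in>insert a A - {k}. f j x))"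
    proof (rule sum.cong)
      fix k assume "k \<in> A"
      then have "insert a A - {k} = insert a (A - {k})" using insert.hyps by auto
      then show "f a x * (f' k x * (\<Prod>j\<in>A - {k}. f j x)) =
          f' k x * (\<Prod>j\<in>insert a A - {k}. f j x)"
        using insert.hyps by (simp add: mult.left_commute)
    qed simp
    moreover have "insert a A - {a} = A" using insert.hyps by auto
    ultimately show ?thesis using insert.hyps by (simp add: sum_distrib_left)
  qed
  moreover have "fps_has_deriv (\<lambda>x. f a x * (\<Prod>j\<in>A. f j x)) (\<lambda>x. f' a x * (\<Prod>j\<in>A. f j x) +
      f a x * (\<Sum>k\<in>A. f' k x * (\<Prod>j\<in>A - {k}. f j x)))"
    using insert by (intro fps_has_deriv_mult) auto
  ultimately show ?case using insert.hyps by (simp only: prod.insert not_False_eq_True)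
qed

lemma fps_has_deriv_integrable:
  assumes "fps_has_deriv f f'"
  shows "(\<lambda>x. fps_nth (f x) n) integrable_on {a..b}"
  using assms unfolding fps_has_deriv_def
  by (intro integrable_continuous_real continuous_at_imp_continuous_on ballI DERIV_isCont) blast

lemma fps_param_integral_deriv:
  assumes "fps_has_deriv f f'" "a \<le> b"
  shows "fps_param_integral a b f' = f b - f a"
proof (rule fps_ext)
  fix n
  have "((\<lambda>x. fps_nth (f' x) n) has_integral fps_nth (f b) n - fps_nth (f a) n) {a..b}"
    using assms unfolding fps_has_deriv_def
    by (intro fundamental_theorem_of_calculus)
       (auto simp: has_real_derivative_iff_has_vector_derivative[symmetric]
         intro: has_field_derivative_at_within)
  then show "fps_nth (fps_param_integral a b f') n = fps_nth (f b - f a) n"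
    by (simp add: fps_param_integral_def integral_unique)
qed

lemma fps_param_integral_scaled_sum:
  assumes "finite A" "\<And>k n. k \<in> A \<Longrightarrow> (\<lambda>x. fps_nth (f k x) n) integrable_on {a..b}"
  shows "fps_param_integral a b (\<lambda>x. \<Sum>k\<in>A. fps_const (c k) * f k x) =
           (\<Sum>k\<in>A. fps_const (c k) * fps_param_integral a b (f k))"
proof (rule fps_ext)
  fix n
  have "integral {a..b} (\<lambda>x. \<Sum>k\<in>A. c k * fps_nth (f k x) n) =
      (\<Sum>k\<in>A. integral {a..b} (\<lambda>x. c k * fps_nth (f k x) n))"
    using assms by (intro integral_sum integrable_on_mult_right)
  then show "fps_nth (fps_param_integral a b (\<lambda>x. \<Sum>k\<in>A. fps_const (c k) * f k x)) n =
      fps_nth (\<Sum>k\<in>A. fps_const (c k) * fps_param_integral a b (f k)) n"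
    by (simp add: fps_param_integral_def fps_sum_nth)
qed


section \<open>The integral formula for all coefficients of the Geode\<close>

text \<open>
  The polynomial $Q_m(x) = \prod_k ((1+z)^{k-2} - x)^{m_k}$. The subtraction in the exponent is
  meant for variables $t_k$ with $k \ge 2$.
\<close>

definition exp_kernel :: "(nat \<Rightarrow>\<^sub>0 nat) \<Rightarrow> real \<Rightarrow> real fps"
  where "exp_kernel m x =
    (\<Prod>k\<in>Poly_Mapping.keys m. ((1 + fps_X) ^ (k - 2) - fps_const x) ^ Poly_Mapping.lookup m k)"

lemma exp_kernel_superset:
  "finite A \<Longrightarrow> Poly_Mapping.keys m \<subseteq> A \<Longrightarrow> exp_kernel m x =
     (\<Prod>k\<in>A. ((1 + fps_X) ^ (k - 2) - fps_const x) ^ Poly_Mapping.lookup m k)"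
  unfolding exp_kernel_def by (rule prod.mono_neutral_left) (auto simp: in_keys_iff)

lemma exp_kernel_deriv:
  assumes "finite A" "Poly_Mapping.keys m \<subseteq> A"
  shows "fps_has_deriv (exp_kernel m)
    (\<lambda>x. \<Sum>k\<in>A. fps_const (- real (Poly_Mapping.lookup m k)) *
                   exp_kernel (m - Poly_Mapping.single k 1) x)"
proof -
  let ?g = "\<lambda>j x. (1 + fps_X) ^ (j - 2) - fps_const x :: real fps"
  let ?mult = "Poly_Mapping.lookup m"
  have "fps_has_deriv (\<lambda>x. \<Prod>j\<in>A. ?g j x ^ ?mult j) (\<lambda>x. \<Sum>k\<in>A.
      (of_nat (?mult k) * (- 1) * ?g k x ^ (?mult k - 1)) * (\<Prod>j\<in>A - {k}. ?g j x ^ ?mult j))"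
    using assms by (intro fps_has_deriv_prod fps_has_deriv_power fps_has_deriv_diff_const)
  moreover have "?g k x ^ (?mult k - 1) * (\<Prod>j\<in>A - {k}. ?g j x ^ ?mult j) =
      exp_kernel (m - Poly_Mapping.single k 1) x" if "k \<in> A" for k x
    using assms keys_lower[of m k] that
    by (subst exp_kernel_superset[of A])
       (auto simp: prod.remove[OF _ that] lookup_lower simp del: One_nat_def)
  then have "(of_nat (?mult k) * (- 1) * ?g k x ^ (?mult k - 1)) * (\<Prod>j\<in>A - {k}. ?g j x ^ ?mult j) =
      fps_const (- real (?mult k)) * exp_kernel (m - Poly_Mapping.single k 1) x" if "k \<in> A" for k x
    using that by (simp add: mult.assoc fps_of_nat flip: fps_const_neg)
  moreover have "exp_kernel m = (\<lambda>x. \<Prod>j\<in>A. ?g j x ^ ?mult j)"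
    using assms by (auto simp: exp_kernel_superset)
  ultimately show ?thesis by simp
qed

lemma exp_kernel_at_0:
  assumes "Poly_Mapping.keys m \<subseteq> {2..}"
  shows "(1 + fps_X) ^ (2 * exp_deg m) * exp_kernel m 0 = (1 + fps_X) ^ exp_weight m"
proof -
  let ?K = "Poly_Mapping.keys m" and ?mult = "Poly_Mapping.lookup m"
  have "(1 + fps_X) ^ (2 * exp_deg m) * exp_kernel m 0 =
      (\<Prod>k\<in>?K. (1 + fps_X) ^ (2 * ?mult k) * ((1 + fps_X) ^ (k - 2)) ^ ?mult k)"
    by (simp add: exp_deg_def exp_kernel_def sum_distrib_left power_sum prod.distrib)
  also have "\<dots> = (\<Prod>k\<in>?K. (1 + fps_X) ^ (k * ?mult k))"
  proof (rule prod.cong)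
    fix k assume "k \<in> ?K"
    then have "2 + (k - 2) = k" using assms by auto
    then have "2 * ?mult k + (k - 2) * ?mult k = k * ?mult k"
      by (simp only: flip: distrib_right)
    then show "(1 + fps_X) ^ (2 * ?mult k) * ((1 + fps_X) ^ (k - 2)) ^ ?mult k =
        ((1 + fps_X) ^ (k * ?mult k) :: real fps)"
      by (simp flip: power_mult power_add)
  qed simp
  also have "\<dots> = (1 + fps_X) ^ exp_weight m"
    by (simp add: exp_weight_def power_sum)
  finally show ?thesis .
qed

lemma exp_kernel_at_1: "fps_X ^ exp_deg m dvd exp_kernel m 1"
proof -
  have "fps_X dvd ((1 + fps_X) ^ j - 1 :: real fps)" for j
    using power_diff_1_eq[of "1 + fps_X :: real fps" j] by simp
  then show ?thesis
    by (simp add: exp_deg_def exp_kernel_def power_sum prod_dvd_prod dvd_power_same)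
qed

text \<open>The claimed value of $G[m]$.\<close>

definition geode_coeff :: "(nat \<Rightarrow>\<^sub>0 nat) \<Rightarrow> real"
  where "geode_coeff m = fact (exp_deg m) / exp_fact m *
    fps_nth ((1 + fps_X) ^ (2 * exp_deg m + 2) * fps_param_integral 0 1 (exp_kernel m)) (exp_deg m)"

text \<open>
  The left-hand side is the coefficient of $t^m$ in the product of $\sum_k t_k$ with the series of
  the \<open>geode_coeff\<close>, the right-hand side the hyper-Catalan number $S[m]$.
\<close>

lemma geode_coeff_lower_sum:
  assumes A: "finite A" "A \<subseteq> {2..}" and m: "Poly_Mapping.keys m \<subseteq> A" "exp_deg m = Suc n"
  shows "(\<Sum>k\<in>A. if Poly_Mapping.lookup m k = 0 then 0
                  else geode_coeff (m - Poly_Mapping.single k 1)) =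
           fact n / exp_fact m * real (exp_weight m choose n)"
proof -
  let ?mult = "Poly_Mapping.lookup m"
  let ?I = "\<lambda>k. fps_param_integral 0 1 (exp_kernel (m - Poly_Mapping.single k 1))"
  let ?P = "(1 + fps_X) ^ (2 * n + 2) :: real fps"
  \<comment> \<open>The factor \<open>?mult k\<close> makes the case distinction superfluous; it turns the multifactorial
    of the lowered vector into that of \<open>m\<close>.\<close>
  have "(if ?mult k = 0 then 0 else geode_coeff (m - Poly_Mapping.single k 1)) =
      - (fact n / exp_fact m * fps_nth (?P * (fps_const (- real (?mult k)) * ?I k)) n)" for k
  proof (cases "?mult k = 0")
    case False
    have "fps_nth (?P * (fps_const (- real (?mult k)) * ?I k)) n =
        - real (?mult k) * fps_nth (?P * ?I k) n"
      by (simp only: mult.left_commute[of ?P] fps_mult_left_const_nth)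
    then show ?thesis
      using exp_fact_lower[OF False] exp_deg_lower[OF False] m False
      by (simp add: geode_coeff_def del: One_nat_def)
  qed simp
  then have "(\<Sum>k\<in>A. if ?mult k = 0 then 0 else geode_coeff (m - Poly_Mapping.single k 1)) =
      - (fact n / exp_fact m *
          fps_nth (?P * (\<Sum>k\<in>A. fps_const (- real (?mult k)) * ?I k)) n)"
    by (simp only: sum_negf fps_sum_nth sum_distrib_left)
  also have "(\<Sum>k\<in>A. fps_const (- real (?mult k)) * ?I k) = exp_kernel m 1 - exp_kernel m 0"
  proof -
    have "(\<lambda>x. fps_nth (exp_kernel l x) j) integrable_on {0..1}" for l j
      using exp_kernel_deriv[OF finite_keys order_refl] by (rule fps_has_deriv_integrable)
    then have "(\<Sum>k\<in>A. fps_const (- real (?mult k)) * ?I k) = fps_param_integral 0 1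
        (\<lambda>x. \<Sum>k\<in>A. fps_const (- real (?mult k)) * exp_kernel (m - Poly_Mapping.single k 1) x)"
      using A by (subst fps_param_integral_scaled_sum) auto
    also have "\<dots> = exp_kernel m 1 - exp_kernel m 0"
      using exp_kernel_deriv[OF A(1) m(1)] by (rule fps_param_integral_deriv) simp
    finally show ?thesis .
  qed
  also have "fps_nth (?P * (exp_kernel m 1 - exp_kernel m 0)) n = - real (exp_weight m choose n)"
  proof -
    obtain r where r: "exp_kernel m 1 = fps_X ^ Suc n * r"
      using exp_kernel_at_1[of m] m by (auto simp: dvd_def)
    have "?P * exp_kernel m 1 = fps_X ^ Suc n * (?P * r)"
      by (simp only: r mult.left_commute)
    then have "fps_nth (?P * exp_kernel m 1) n = 0"
      by (simp only: fps_X_power_mult_nth) simp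
    moreover have "?P * exp_kernel m 0 = (1 + fps_X) ^ exp_weight m"
      using exp_kernel_at_0[of m] A m by (auto simp: subset_trans)
    moreover have "fps_nth ((1 + fps_X) ^ exp_weight m :: real fps) n = real (exp_weight m choose n)"
      by (simp add: binomial_gbinomial flip: fps_binomial_of_nat)
    ultimately show ?thesis by (simp add: right_diff_distrib)
  qed
  finally show ?thesis by simp
qed

theorem mfps_coeff_geode:
  assumes D: "D \<ge> 1" and m: "Poly_Mapping.keys m \<subseteq> {2..D+1}"
  shows "mfps_coeff (geode D) m = geode_coeff m"
proof -
  let ?A = "{2..D+1}" and ?S = "hyper_catalan D"
  define G where
    "G = Abs_mfps (\<lambda>m. if Poly_Mapping.keys m \<subseteq> ?A then geode_coeff m else 0)"
  have G_in: "G \<in> mfps_in ?A"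
    by (auto simp: G_def mfps_in_def)
  have "?S - 1 = (\<Sum>k=2..D+1. mfps_var k) * G"
  proof (rule mfps_eqI)
    fix m
    have in_A: "?S - 1 \<in> mfps_in ?A" "(\<Sum>k=2..D+1. mfps_var k) * G \<in> mfps_in ?A"
      using hyper_catalan_in G_in
      by (blast intro: mfps_in_diff mfps_in_1, blast intro: mfps_in_mult mfps_in_sum mfps_in_var)
    have coeff: "mfps_coeff ((\<Sum>k=2..D+1. mfps_var k) * G) m =
        (\<Sum>k=2..D+1. if Poly_Mapping.lookup m k = 0 then 0
                      else mfps_coeff G (m - Poly_Mapping.single k 1))"
      by (simp only: sum_distrib_right mfps_coeff_sum mfps_coeff_var_mult)
    consider "\<not> Poly_Mapping.keys m \<subseteq> ?A" | "m = 0"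
      | n where "Poly_Mapping.keys m \<subseteq> ?A" "exp_deg m = Suc n"
      by (metis exp_deg_eq_0_iff not0_implies_Suc)
    then show "mfps_coeff (?S - 1) m = mfps_coeff ((\<Sum>k=2..D+1. mfps_var k) * G) m"
    proof cases
      case 1
      then show ?thesis using in_A by (auto simp: mfps_in_def)
    next
      case 2
      then show ?thesis
        using mfps_coeff_0_power_solution[OF hyper_catalan_eq[of D], of 1] coeff
        by (simp add: mfps_coeff_1)
    next
      case 3
      have "mfps_coeff ((\<Sum>k=2..D+1. mfps_var k) * G) m =
          (\<Sum>k=2..D+1. if Poly_Mapping.lookup m k = 0 then 0
                        else geode_coeff (m - Poly_Mapping.single k 1))"
        unfolding coeff
        by (simp add: G_def order_trans[OF keys_lower 3(1)] del: One_nat_def sum.cl_ivl_Suc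
            cong: if_cong)
      also have "\<dots> = fact n / exp_fact m * real (exp_weight m choose n)"
        using 3 by (intro geode_coeff_lower_sum) auto
      also have "\<dots> = mfps_coeff (?S - 1) m"
        using mfps_coeff_power_solution[OF _ hyper_catalan_eq[of D] 3, of 1] 3
        by (auto simp: mfps_coeff_1)
      finally show ?thesis by simp
    qed
  qed
  with G_in have "geode D = G"
    unfolding geode_def using geode_ex1[OF D] by (intro the1_equality) auto
  then show ?thesis using m by (simp add: G_def)
qed


section \<open>The diagonal coefficients\<close>

lemma lookup_diag_exponent:
  "Poly_Mapping.lookup (diag_exponent D M) k = (if k \<in> {2..D+1} then M else 0)"
  by (simp add: diag_exponent_def lookup_sum lookup_single when_def del: sum.cl_ivl_Suc)

lemma keys_diag_exponent: "Poly_Mapping.keys (diag_exponent D M) \<subseteq> {2..D+1}"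
  by (auto simp: in_keys_iff lookup_diag_exponent split: if_splits)

lemma exp_kernel_diag_exponent:
  assumes "D \<ge> 1"
  shows "exp_kernel (diag_exponent D M) x = geode_kernel (D - 1) x ^ M"
proof -
  let ?g = "\<lambda>k. (1 + fps_X) ^ k - fps_const x :: real fps"
  have "exp_kernel (diag_exponent D M) x = (\<Prod>k=2..D+1. ?g (k - 2)) ^ M"
    using keys_diag_exponent
    by (simp add: exp_kernel_superset[of "{2..D+1}"] lookup_diag_exponent prod_power_distrib
          del: prod.cl_ivl_Suc)
  also have "(\<Prod>k=2..D+1. ?g (k - 2)) = (\<Prod>k=0..D-1. ?g k)"
    by (rule prod.reindex_bij_witness[of _ "\<lambda>k. k + 2" "\<lambda>k. k - 2"]) (use assms in auto)
  also have "\<dots> = geode_kernel (D - 1) x"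
    by (simp add: geode_kernel_def prod.atLeast_Suc_atMost)
  finally show ?thesis .
qed

theorem theorem10p4:
  fixes D M d s E :: nat
  assumes "D \<ge> 1"
    and "d = D - 1"
    and "s = d * (d + 1) div 2"
    and "E = ((\<Sum>k=2..D+1. k) - s) * M + 2"
  shows "geode_diag D M =
    fact (D * M) / fact M ^ D *
    fps_nth ((1 + fps_X) ^ E * fps_param_integral 0 1 (\<lambda>x. geode_kernel d x ^ M)) (D * M)"
proof -
  let ?m = "diag_exponent D M"
  have "exp_deg ?m = D * M"
    by (simp add: exp_deg_superset[OF _ keys_diag_exponent] lookup_diag_exponent)
  moreover have "exp_fact ?m = fact M ^ D"
    by (simp add: exp_fact_superset[OF _ keys_diag_exponent] lookup_diag_exponent)
  moreover have "E = 2 * (D * M) + 2"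
    using geode_exponent_diff(2)[OF assms(1)] assms(2-4) by simp
  moreover have "exp_kernel ?m = (\<lambda>x. geode_kernel d x ^ M)"
    using exp_kernel_diag_exponent[OF assms(1)] assms(2) by auto
  ultimately show ?thesis
    unfolding geode_diag_def mfps_coeff_geode[OF assms(1) keys_diag_exponent]
    by (simp add: geode_coeff_def)
qed

end
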